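(* Consider $n$ nodes placed at the integer points $1, \ldots, n$ of the real line. Let each node be connected to its immediate neighbors (at distance $1$) and to $\ell$ long-distance neighbors chosen independently with replacement, where each long-distance neighbor $v$ of node $u$ is chosen with probability $\frac{1/d(u,v)}{\sum_{v' \neq u} 1/d(u,v')}$, with $d(u,v)=|u-v|$, and $\ell \in [1, \lg n]$. Assume the links to the immediate neighbors are always present, and that each long-distance link is present independently with probability $p$. Messages are routed greedily along present links, each node forwarding the message to its neighbor closest to the target. Then the expected delivery time is $O(\log^2 n / (p\ell))$.
   Context: $\lg = \log_2$. The delivery time is the number of hops taken to route a message from a source to a target node. *)

theory Defs
  imports "HOL-Probability.Probability"
begin

definition node_dist :: "nat \<Rightarrow> nat \<Rightarrow> real" where
  "node_dist u v = \<bar>real u - real v\<bar>"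

definition link_prob :: "nat \<Rightarrow> nat \<Rightarrow> nat \<Rightarrow> real" where
  "link_prob n u v =
     (if v \<in> {1..n} - {u}
      then (1 / node_dist u v) / (\<Sum>v' \<in> {1..n} - {u}. 1 / node_dist u v')
      else 0)"

definition link_pmf :: "nat \<Rightarrow> nat \<Rightarrow> nat pmf" where
  "link_pmf n u = embed_pmf (link_prob n u)"

text \<open>
  An outcome \<open>\<omega>\<close> maps \<open>(u, i)\<close> to the endpoint of the \<open>i\<close>-th long-distance link drawn by
  node \<open>u\<close> and a flag telling whether that link is present. All endpoints and all flags
  are independent.
\<close>

type_synonym network = "nat \<times> nat \<Rightarrow> nat \<times> bool"

definition network_pmf :: "nat \<Rightarrow> nat \<Rightarrow> real \<Rightarrow> network pmf" where
  "network_pmf n l p =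
     Pi_pmf ({1..n} \<times> {..<l}) (0, False)
       (\<lambda>(u, i). pair_pmf (link_pmf n u) (bernoulli_pmf p))"

definition neighbours :: "nat \<Rightarrow> nat \<Rightarrow> network \<Rightarrow> nat \<Rightarrow> nat set" where
  "neighbours n l \<omega> u =
     {v \<in> {1..n}. node_dist u v = 1} \<union> {fst (\<omega> (u, i)) |i. i < l \<and> snd (\<omega> (u, i))}"

text \<open>
  A rule takes the current node, the target and the set of present neighbours. Two
  neighbours on opposite sides of the target may be equally close to it; a rule may break
  such ties arbitrarily.
\<close>

definition greedy_rule :: "(nat \<Rightarrow> nat \<Rightarrow> nat set \<Rightarrow> nat) \<Rightarrow> bool" where
  "greedy_rule g \<longleftrightarrow>
     (\<forall>u t N. finite N \<longrightarrow> N \<noteq> {} \<longrightarrow> is_arg_min (\<lambda>v. node_dist v t) (\<lambda>v. v \<in> N) (g u t N))"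

definition hop ::
  "(nat \<Rightarrow> nat \<Rightarrow> nat set \<Rightarrow> nat) \<Rightarrow> nat \<Rightarrow> nat \<Rightarrow> network \<Rightarrow> nat \<Rightarrow> nat \<Rightarrow> nat" where
  "hop g n l \<omega> t u = g u t (neighbours n l \<omega> u)"

definition delivery_time ::
  "(nat \<Rightarrow> nat \<Rightarrow> nat set \<Rightarrow> nat) \<Rightarrow> nat \<Rightarrow> nat \<Rightarrow> network \<Rightarrow> nat \<Rightarrow> nat \<Rightarrow> nat" where
  "delivery_time g n l \<omega> s t = (LEAST k. (hop g n l \<omega> t ^^ k) s = t)"

definition expected_delivery_time ::
  "(nat \<Rightarrow> nat \<Rightarrow> nat set \<Rightarrow> nat) \<Rightarrow> nat \<Rightarrow> nat \<Rightarrow> real \<Rightarrow> nat \<Rightarrow> nat \<Rightarrow> real" where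
  "expected_delivery_time g n l p s t =
     measure_pmf.expectation (network_pmf n l p) (\<lambda>\<omega>. real (delivery_time g n l \<omega> s t))"

text \<open>
  The following facts show that the totalised operators used above (\<open>embed_pmf\<close>, \<open>LEAST\<close>,
  the Bochner integral) are applied within their proper domain.
\<close>

lemma node_dist_pos: "u \<noteq> v \<Longrightarrow> 0 < node_dist u v"
  by (simp add: node_dist_def)

lemma link_sum_pos:
  assumes "n \<ge> 2"
  shows "0 < (\<Sum>v' \<in> {1..n} - {u}. 1 / node_dist u v')"
proof -
  have "(if u = 1 then 2 else 1) \<in> {1..n} - {u}" using assms by auto
  then have "{1..n} - {u} \<noteq> {}" by blast
  then show ?thesis
    by (intro sum_pos) (auto intro!: node_dist_pos simp: node_dist_def)
qed

lemma pmf_link_pmf: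
  assumes "n \<ge> 2"
  shows "pmf (link_pmf n u) v = link_prob n u v"
  unfolding link_pmf_def
proof (rule pmf_embed_pmf)
  let ?A = "{1..n} - {u}" and ?S = "\<Sum>v' \<in> {1..n} - {u}. 1 / node_dist u v'"
  have S: "?S > 0" by (rule link_sum_pos[OF assms])
  show nn: "0 \<le> link_prob n u x" for x
    using S by (simp add: link_prob_def node_dist_def)
  have "(\<integral>\<^sup>+ x. ennreal (link_prob n u x) \<partial>count_space UNIV) =
        (\<Sum>x\<in>?A. ennreal (link_prob n u x))"
    by (rule nn_integral_count_space'[of ?A]) (auto simp: link_prob_def)
  also have "\<dots> = ennreal (\<Sum>x\<in>?A. link_prob n u x)"
    by (rule sum_ennreal) (rule nn)
  also have "(\<Sum>x\<in>?A. link_prob n u x) = (\<Sum>x\<in>?A. (1 / node_dist u x) / ?S)"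
    by (rule sum.cong) (auto simp: link_prob_def)
  also have "\<dots> = 1"
    using S by (subst sum_divide_distrib[symmetric]) simp
  finally show "(\<integral>\<^sup>+ x. ennreal (link_prob n u x) \<partial>count_space UNIV) = 1" by simp
qed

lemma set_link_pmf: "n \<ge> 2 \<Longrightarrow> set_pmf (link_pmf n u) \<subseteq> {1..n} - {u}"
  by (auto simp: set_pmf_iff pmf_link_pmf link_prob_def split: if_splits)

lemma finite_set_network_pmf:
  assumes "n \<ge> 2"
  shows "finite (set_pmf (network_pmf n l p))"
proof -
  have "finite (set_pmf (link_pmf n u))" for u
    using set_link_pmf[OF assms] by (rule finite_subset) simp
  then show ?thesis
    unfolding network_pmf_def
    by (subst set_Pi_pmf) (auto intro!: finite_PiE_dflt)
qed

lemma greedy_rule_exists: "\<exists>g. greedy_rule g"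
proof -
  have "is_arg_min (\<lambda>v. node_dist v t) (\<lambda>v. v \<in> N) (arg_min_on (\<lambda>v. node_dist v t) N)"
    if "finite N" "N \<noteq> {}" for t N
    using arg_min_if_finite[OF that, of "\<lambda>v. node_dist v t"] by (auto simp: is_arg_min_def)
  then have "greedy_rule (\<lambda>u t N. arg_min_on (\<lambda>v. node_dist v t) N)"
    by (simp add: greedy_rule_def)
  then show ?thesis by blast
qed

lemma network_endpoint:
  assumes "n \<ge> 2" "\<omega> \<in> set_pmf (network_pmf n l p)" "u \<in> {1..n}" "i < l"
  shows "fst (\<omega> (u, i)) \<in> {1..n} - {u}"
proof -
  have "\<omega> (u, i) \<in> set_pmf (pair_pmf (link_pmf n u) (bernoulli_pmf p))"
    using assms unfolding network_pmf_def by (auto simp: set_Pi_pmf PiE_dflt_def)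
  then show ?thesis using set_link_pmf[OF assms(1), of u] by auto
qed

lemma hop_closer:
  assumes "greedy_rule g" "n \<ge> 2" "\<omega> \<in> set_pmf (network_pmf n l p)"
    and "u \<in> {1..n}" "t \<in> {1..n}" "u \<noteq> t"
  shows "hop g n l \<omega> t u \<in> {1..n}" and "node_dist (hop g n l \<omega> t u) t \<le> node_dist u t - 1"
proof -
  let ?N = "neighbours n l \<omega> u"
  define w where "w = (if u < t then u + 1 else u - 1)"
  have w: "w \<in> ?N" "node_dist w t = node_dist u t - 1"
    using assms(4-6) by (auto simp: w_def neighbours_def node_dist_def)
  have sub: "?N \<subseteq> {1..n}"
    using network_endpoint[OF assms(2-4)] by (auto simp: neighbours_def)
  then have "finite ?N" by (rule finite_subset) simp
  with w(1) assms(1) have "is_arg_min (\<lambda>v. node_dist v t) (\<lambda>v. v \<in> ?N) (hop g n l \<omega> t u)"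
    unfolding greedy_rule_def hop_def by blast
  with w sub show "hop g n l \<omega> t u \<in> {1..n}"
    and "node_dist (hop g n l \<omega> t u) t \<le> node_dist u t - 1"
    unfolding is_arg_min_def by (blast, metis linorder_not_less)
qed

lemma delivered:
  assumes "greedy_rule g" "n \<ge> 2" "\<omega> \<in> set_pmf (network_pmf n l p)"
    and "s \<in> {1..n}" "t \<in> {1..n}"
  shows "(hop g n l \<omega> t ^^ delivery_time g n l \<omega> s t) s = t"
proof -
  have "\<exists>k. (hop g n l \<omega> t ^^ k) u = t" if "u \<in> {1..n}" "node_dist u t \<le> real m" for u m
    using that
  proof (induction m arbitrary: u)
    case 0
    then have "(hop g n l \<omega> t ^^ 0) u = t" by (simp add: node_dist_def)
    then show ?case ..
  next
    case (Suc m)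
    show ?case
    proof (cases "u = t")
      case True
      then have "(hop g n l \<omega> t ^^ 0) u = t" by simp
      then show ?thesis ..
    next
      case False
      note h = hop_closer[OF assms(1-3) Suc.prems(1) assms(5) False]
      have "node_dist (hop g n l \<omega> t u) t \<le> real m" using h(2) Suc.prems(2) by simp
      then obtain k where "(hop g n l \<omega> t ^^ k) (hop g n l \<omega> t u) = t"
        using Suc.IH[OF h(1)] by blast
      then have "(hop g n l \<omega> t ^^ Suc k) u = t" by (simp add: funpow_swap1)
      then show ?thesis ..
    qed
  qed
  from this[OF assms(4), of "nat \<lceil>node_dist s t\<rceil>"]
  have "\<exists>k. (hop g n l \<omega> t ^^ k) s = t"
    using real_nat_ceiling_ge by blast
  then show ?thesis unfolding delivery_time_def by (rule LeastI_ex)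
qed

lemma integrable_delivery_time:
  "n \<ge> 2 \<Longrightarrow>
   integrable (measure_pmf (network_pmf n l p)) (\<lambda>\<omega>. real (delivery_time g n l \<omega> s t))"
  by (rule integrable_measure_pmf_finite[OF finite_set_network_pmf])

end

theory Submission
  imports Defs
begin

text \<open>
  Let \<open>d = |u - t|\<close>. The nodes between \<open>u\<close> and \<open>t\<close> within \<open>d/2\<close> of \<open>t\<close> number at least \<open>d/2\<close> and
  lie within \<open>d\<close> of \<open>u\<close>, while the normalising sum at \<open>u\<close> is at most \<open>2 H\<^sub>n \<le> 4 lg n\<close>. So one
  long link halves the distance with probability at least \<open>1/(8 lg n)\<close>, and since \<open>\<ell> \<le> lg n\<close>
  some present link of \<open>u\<close> does so with probability at least \<open>q = p\<ell>/(9 lg n)\<close>.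

  Greedy routing from \<open>u\<close> never returns to distance \<open>d\<close> or more, so after the first hop the
  delivery time depends only on the links of other nodes, which are independent of that hop.
  The potential \<open>\<Phi> d = 1 + lg d\<close> (with \<open>\<Phi> 0 = 0\<close>) is nondecreasing and drops by at least 1 on
  halving, hence by at least \<open>q\<close> in expectation per hop; induction on \<open>d\<close> bounds the expected
  delivery time by \<open>\<Phi> d / q\<close>.
\<close>

section \<open>The logarithmic potential and two analytic estimates\<close>

text \<open>Distances are integers, so a value below 1 means arrival. The jump at 1 makes halving
  cost a full unit even for \<open>1 \<le> x < 2\<close>, where \<open>x / 2\<close> counts as
  arrived.\<close>

definition log_potential :: "real \<Rightarrow> real" where
  "log_potential x = (if x < 1 then 0 else 1 + log 2 x)"

lemma log_potential_nonneg: "0 \<le> log_potential x"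
  by (simp add: log_potential_def)

lemma log_potential_mono: "x \<le> y \<Longrightarrow> log_potential x \<le> log_potential y"
  by (auto simp: log_potential_def)

lemma log_potential_half:
  assumes "1 \<le> x"
  shows "log_potential (x / 2) \<le> log_potential x - 1"
  using assms by (auto simp: log_potential_def log_divide)

text \<open>Both inequalities are \<open>1 + y \<le> exp y\<close>. The bound serves to estimate
  from below the chance that one of \<open>k\<close> independent trials succeeds.\<close>

lemma one_minus_power_le:
  fixes x :: real
  assumes "0 \<le> x" "x \<le> 1"
  shows "(1 - x) ^ k \<le> 1 / (1 + real k * x)"
proof -
  have "(1 - x) ^ k \<le> exp (- x) ^ k"
    using assms exp_ge_add_one_self[of "- x"] by (intro power_mono) auto
  also have "\<dots> = 1 / exp (real k * x)"
    by (simp add: exp_of_nat_mult[symmetric] exp_minus divide_simps)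
  also have "\<dots> \<le> 1 / (1 + real k * x)"
    using assms by (intro divide_left_mono exp_ge_add_one_self mult_pos_pos add_pos_nonneg) auto
  finally show ?thesis .
qed

text \<open>On each side of \<open>u\<close> the distances are distinct numbers in
  \<open>{1..n}\<close>, so each side contributes at most the harmonic number
  \<open>harm n\<close>.\<close>

lemma link_sum_le:
  assumes "n \<ge> 2" "u \<in> {1..n}"
  shows "(\<Sum>v \<in> {1..n} - {u}. 1 / node_dist u v) \<le> 4 * log 2 (real n)"
proof -
  have below: "(\<Sum>v\<in>{1..<u}. 1 / node_dist u v) \<le> harm n"
  proof -
    have "(\<Sum>v\<in>{1..<u}. 1 / node_dist u v) = (\<Sum>k\<in>(\<lambda>v. u - v) ` {1..<u}. inverse (real k))"
      by (subst sum.reindex)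
         (auto intro!: inj_onI sum.cong simp: node_dist_def inverse_eq_divide of_nat_diff)
    also have "\<dots> \<le> (\<Sum>k\<in>{1..n}. inverse (real k))"
      using assms(2) by (intro sum_mono2) auto
    finally show ?thesis by (simp add: harm_def)
  qed
  have above: "(\<Sum>v\<in>{u<..n}. 1 / node_dist u v) \<le> harm n"
  proof -
    have "(\<Sum>v\<in>{u<..n}. 1 / node_dist u v) = (\<Sum>k\<in>(\<lambda>v. v - u) ` {u<..n}. inverse (real k))"
      by (subst sum.reindex)
         (auto intro!: inj_onI sum.cong simp: node_dist_def inverse_eq_divide of_nat_diff)
    also have "\<dots> \<le> (\<Sum>k\<in>{1..n}. inverse (real k))"
      by (intro sum_mono2) auto
    finally show ?thesis by (simp add: harm_def)
  qed
  have L: "1 \<le> log 2 (real n)" using assms(1) by simp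
  have "ln (real n) = ln 2 * log 2 (real n)" by (simp add: log_def)
  also have "\<dots> \<le> 1 * log 2 (real n)"
    using ln_2_less_1 L by (intro mult_right_mono) auto
  finally have ln: "ln (real n) \<le> log 2 (real n)" by simp
  have "{1..n} - {u} = {1..<u} \<union> {u<..n}" using assms(2) by auto
  then have "(\<Sum>v \<in> {1..n} - {u}. 1 / node_dist u v) =
      (\<Sum>v\<in>{1..<u} \<union> {u<..n}. 1 / node_dist u v)" by (rule arg_cong)
  also have "\<dots> = (\<Sum>v\<in>{1..<u}. 1 / node_dist u v) + (\<Sum>v\<in>{u<..n}. 1 / node_dist u v)"
    by (rule sum.union_disjoint) auto
  also have "\<dots> \<le> 2 * harm n" using below above by simp
  \<comment> \<open>\<open>harm k - ln k\<close> is decreasing in \<open>k\<close> and equals 1 at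
    \<open>k = 1\<close>.\<close>
  also have "\<dots> \<le> 2 * (1 + ln (real n))"
    using euler_mascheroni_sequence_decreasing[of 1 n] assms(1) by (simp add: harm_def)
  also have "\<dots> \<le> 4 * log 2 (real n)" using ln L by simp
  finally show ?thesis .
qed

section \<open>Hitting times of iterated maps and the locality of greedy routing\<close>

lemma Least_funpow_step:
  assumes "(h ^^ k) v = t" "v \<noteq> t"
  shows "(LEAST j. (h ^^ j) v = t) = Suc (LEAST j. (h ^^ j) (h v) = t)"
proof -
  have "(LEAST j. (h ^^ j) v = t) = Suc (LEAST j. (h ^^ Suc j) v = t)"
    using assms by (intro Least_Suc[where P = "\<lambda>j. (h ^^ j) v = t"]) auto
  then show ?thesis unfolding funpow_Suc_right by simp
qed

text \<open>Before reaching \<open>t\<close> the orbit stays in \<open>A\<close>, where both maps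
  agree, so the two orbits coincide up to the hit. The existence claim is carried along because
  \<open>Least_funpow_step\<close> for \<open>h'\<close> requires a witness.\<close>

lemma Least_funpow_cong:
  assumes "\<And>x. x \<in> A \<Longrightarrow> x \<noteq> t \<Longrightarrow> h x \<in> A \<and> h' x = h x"
    and "v \<in> A" and "(h ^^ k) v = t"
  shows "(\<exists>j. (h' ^^ j) v = t) \<and> (LEAST j. (h' ^^ j) v = t) = (LEAST j. (h ^^ j) v = t)"
  using assms(2,3)
proof (induction k arbitrary: v)
  case 0
  then have "v = t" by simp
  then show ?case by (auto intro: exI[of _ 0])
next
  case (Suc k)
  show ?case
  proof (cases "v = t")
    case True
    then show ?thesis by (auto intro: exI[of _ 0])
  next
    case False
    have hv: "h v \<in> A" "h' v = h v" using assms(1) Suc.prems(1) False by blast+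
    have k: "(h ^^ k) (h v) = t" using Suc.prems(2) by (simp add: funpow_swap1)
    from Suc.IH[OF hv(1) k] obtain j where j: "(h' ^^ j) (h v) = t"
      and eq: "(LEAST j. (h' ^^ j) (h v) = t) = (LEAST j. (h ^^ j) (h v) = t)" by blast
    have j': "(h' ^^ Suc j) v = t" using j hv(2) by (simp add: funpow_swap1)
    show ?thesis
      using Least_funpow_step[OF j' False] Least_funpow_step[OF Suc.prems(2) False] hv(2) eq j'
      by metis
  qed
qed

lemma delivery_time_target: "delivery_time g n l \<omega> t t = 0"
  unfolding delivery_time_def by (rule Least_eq_0) simp

lemma delivery_time_step:
  assumes "greedy_rule g" "n \<ge> 2" "\<omega> \<in> set_pmf (network_pmf n l p)"
    and "u \<in> {1..n}" "t \<in> {1..n}" "u \<noteq> t"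
  shows "delivery_time g n l \<omega> u t = Suc (delivery_time g n l \<omega> (hop g n l \<omega> t u) t)"
  unfolding delivery_time_def
  by (rule Least_funpow_step[OF delivered[OF assms(1-5)] assms(6)])

lemma hop_cong_row:
  assumes "\<And>i. i < l \<Longrightarrow> \<omega> (u, i) = \<omega>' (u, i)"
  shows "hop g n l \<omega> t u = hop g n l \<omega>' t u"
proof -
  have "neighbours n l \<omega> u = neighbours n l \<omega>' u"
    using assms unfolding neighbours_def by (metis (no_types, lifting))
  then show ?thesis by (simp add: hop_def)
qed

text \<open>Each hop strictly decreases the distance to \<open>t\<close>, so a route starting closer
  than \<open>u\<close> never reads the links of \<open>u\<close>. Only \<open>\<omega>\<close> must
  lie in the support, so \<open>\<omega>'\<close> may hold default entries at
  \<open>u\<close>.\<close>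

lemma delivery_time_cong_rows:
  assumes "greedy_rule g" "n \<ge> 2" "\<omega> \<in> set_pmf (network_pmf n l p)"
    and "v \<in> {1..n}" "t \<in> {1..n}" "node_dist v t < node_dist u t"
    and "\<And>w i. w \<in> {1..n} \<Longrightarrow> w \<noteq> u \<Longrightarrow> i < l \<Longrightarrow> \<omega> (w, i) = \<omega>' (w, i)"
  shows "delivery_time g n l \<omega> v t = delivery_time g n l \<omega>' v t"
proof -
  let ?A = "{x \<in> {1..n}. node_dist x t < node_dist u t}"
  have "hop g n l \<omega> t x \<in> ?A \<and> hop g n l \<omega>' t x = hop g n l \<omega> t x" if "x \<in> ?A" "x \<noteq> t" for x
  proof -
    have "hop g n l \<omega> t x \<in> ?A"
      using hop_closer[OF assms(1-3) _ assms(5) that(2)] that(1) by fastforce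
    moreover have "hop g n l \<omega>' t x = hop g n l \<omega> t x"
      using that(1) by (intro hop_cong_row assms(7)[symmetric]) auto
    ultimately show ?thesis ..
  qed
  from Least_funpow_cong[OF this _ delivered[OF assms(1-5)]] assms(4,6) show ?thesis
    by (simp add: delivery_time_def)
qed

section \<open>Separating the links of one node from all others\<close>

abbreviation endpoint_pmf :: "nat \<Rightarrow> real \<Rightarrow> nat \<times> nat \<Rightarrow> (nat \<times> bool) pmf" where
  "endpoint_pmf n p \<equiv> \<lambda>(u, i). pair_pmf (link_pmf n u) (bernoulli_pmf p)"

text \<open>A row holds the long links of one node. \<open>Pi_pmf\<close> fills all other
  coordinates with an absent link, so a sample is again a \<open>network\<close> and
  \<open>hop\<close> applies to it directly.\<close>

definition row_pmf :: "nat \<Rightarrow> nat \<Rightarrow> real \<Rightarrow> nat \<Rightarrow> network pmf" where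
  "row_pmf n l p u = Pi_pmf ({u} \<times> {..<l}) (0, False) (endpoint_pmf n p)"

definition other_rows_pmf :: "nat \<Rightarrow> nat \<Rightarrow> real \<Rightarrow> nat \<Rightarrow> network pmf" where
  "other_rows_pmf n l p u = Pi_pmf (({1..n} - {u}) \<times> {..<l}) (0, False) (endpoint_pmf n p)"

definition join_row :: "nat \<Rightarrow> nat \<Rightarrow> network \<Rightarrow> network \<Rightarrow> network" where
  "join_row l u f h = (\<lambda>x. if x \<in> {u} \<times> {..<l} then f x else h x)"

lemma network_pmf_split:
  assumes "u \<in> {1..n}"
  shows "network_pmf n l p =
    map_pmf (\<lambda>(f, h). join_row l u f h) (pair_pmf (row_pmf n l p u) (other_rows_pmf n l p u))"
proof -
  have "{1..n} \<times> {..<l} = {u} \<times> {..<l} \<union> ({1..n} - {u}) \<times> {..<l}" using assms by auto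
  then have "network_pmf n l p =
    Pi_pmf ({u} \<times> {..<l} \<union> ({1..n} - {u}) \<times> {..<l}) (0, False) (endpoint_pmf n p)"
    unfolding network_pmf_def by simp
  also have "\<dots> = map_pmf (\<lambda>(f, h) x. if x \<in> {u} \<times> {..<l} then f x else h x)
      (pair_pmf (row_pmf n l p u) (other_rows_pmf n l p u))"
    unfolding row_pmf_def other_rows_pmf_def by (rule Pi_pmf_union) auto
  finally show ?thesis by (simp add: join_row_def)
qed

lemma join_row_in_network:
  assumes "u \<in> {1..n}" "f \<in> set_pmf (row_pmf n l p u)" "h \<in> set_pmf (other_rows_pmf n l p u)"
  shows "join_row l u f h \<in> set_pmf (network_pmf n l p)"
  using assms(2,3) by (auto simp: network_pmf_split[OF assms(1)])

lemma nn_integral_network_split: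
  assumes "u \<in> {1..n}"
  shows "(\<integral>\<^sup>+ \<omega>. F \<omega> \<partial>network_pmf n l p) =
    (\<integral>\<^sup>+ f. \<integral>\<^sup>+ h. F (join_row l u f h) \<partial>other_rows_pmf n l p u \<partial>row_pmf n l p u)"
  by (simp add: network_pmf_split[OF assms] nn_integral_pair_pmf')

text \<open>A hop from \<open>u\<close> reads only the row of \<open>u\<close>; completing
  \<open>f\<close> by any possible other rows reduces the claim to
  \<open>hop_closer\<close>.\<close>

lemma hop_row:
  assumes "greedy_rule g" "n \<ge> 2" "u \<in> {1..n}" "t \<in> {1..n}" "u \<noteq> t"
    and "f \<in> set_pmf (row_pmf n l p u)"
  shows "hop g n l f t u \<in> {1..n}" "node_dist (hop g n l f t u) t \<le> node_dist u t - 1"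
proof -
  obtain h where h: "h \<in> set_pmf (other_rows_pmf n l p u)"
    using set_pmf_not_empty by fast
  have "hop g n l f t u = hop g n l (join_row l u f h) t u"
    by (rule hop_cong_row) (simp add: join_row_def)
  with hop_closer[OF assms(1,2) join_row_in_network[OF assms(3,6) h] assms(3-5)]
  show "hop g n l f t u \<in> {1..n}" "node_dist (hop g n l f t u) t \<le> node_dist u t - 1"
    by simp_all
qed

lemma delivery_time_join_row:
  assumes "greedy_rule g" "n \<ge> 2" "u \<in> {1..n}" "t \<in> {1..n}"
    and "f \<in> set_pmf (row_pmf n l p u)" "h \<in> set_pmf (other_rows_pmf n l p u)"
    and "v \<in> {1..n}" "node_dist v t < node_dist u t"
  shows "delivery_time g n l (join_row l u f h) v t = delivery_time g n l h v t"
  by (rule delivery_time_cong_rows[OF assms(1,2) join_row_in_network[OF assms(3,5,6)] assms(7,4,8)])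
     (simp add: join_row_def)

text \<open>After splitting the network the integrand is constant in the row of \<open>u\<close>, so
  the outer integral over a probability measure disappears.\<close>

lemma nn_integral_delivery_time_other_rows:
  assumes "greedy_rule g" "n \<ge> 2" "u \<in> {1..n}" "t \<in> {1..n}"
    and "v \<in> {1..n}" "node_dist v t < node_dist u t"
  shows "(\<integral>\<^sup>+ h. ennreal (real (delivery_time g n l h v t)) \<partial>other_rows_pmf n l p u) =
    (\<integral>\<^sup>+ \<omega>. ennreal (real (delivery_time g n l \<omega> v t)) \<partial>network_pmf n l p)"
proof -
  have "(\<integral>\<^sup>+ \<omega>. ennreal (real (delivery_time g n l \<omega> v t)) \<partial>network_pmf n l p) =
    (\<integral>\<^sup>+ f. \<integral>\<^sup>+ h. ennreal (real (delivery_time g n l h v t))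
       \<partial>other_rows_pmf n l p u \<partial>row_pmf n l p u)"
    unfolding nn_integral_network_split[OF assms(3)]
    by (intro nn_integral_cong_AE AE_pmfI)
       (simp add: delivery_time_join_row[OF assms(1-4) _ _ assms(5,6)] cong: nn_integral_cong_AE)
  then show ?thesis by simp
qed

text \<open>A renewal equation: the row \<open>f\<close> fixes the first hop, and the remaining
  route may be measured on a fresh network drawn independently of \<open>f\<close>.\<close>

lemma nn_integral_delivery_time_step:
  assumes "greedy_rule g" "n \<ge> 2" "u \<in> {1..n}" "t \<in> {1..n}" "u \<noteq> t"
  shows "(\<integral>\<^sup>+ \<omega>. ennreal (real (delivery_time g n l \<omega> u t)) \<partial>network_pmf n l p) =
    (\<integral>\<^sup>+ f. 1 + (\<integral>\<^sup>+ \<omega>. ennreal (real (delivery_time g n l \<omega> (hop g n l f t u) t))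
       \<partial>network_pmf n l p) \<partial>row_pmf n l p u)"
  unfolding nn_integral_network_split[OF assms(3),
    where F = "\<lambda>\<omega>. ennreal (real (delivery_time g n l \<omega> u t))"]
proof (intro nn_integral_cong_AE AE_pmfI)
  fix f assume f: "f \<in> set_pmf (row_pmf n l p u)"
  let ?v = "hop g n l f t u"
  have v: "?v \<in> {1..n}" "node_dist ?v t < node_dist u t"
    using hop_row[OF assms f] by auto
  have "delivery_time g n l (join_row l u f h) u t = Suc (delivery_time g n l h ?v t)"
    if h: "h \<in> set_pmf (other_rows_pmf n l p u)" for h
  proof -
    have "hop g n l (join_row l u f h) t u = ?v"
      by (rule hop_cong_row) (simp add: join_row_def)
    then show ?thesis
      using delivery_time_step[OF assms(1,2) join_row_in_network[OF assms(3) f h] assms(3-5)]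
        delivery_time_join_row[OF assms(1-4) f h v] by simp
  qed
  then have "(\<integral>\<^sup>+ h. ennreal (real (delivery_time g n l (join_row l u f h) u t))
      \<partial>other_rows_pmf n l p u) =
    (\<integral>\<^sup>+ h. 1 + ennreal (real (delivery_time g n l h ?v t)) \<partial>other_rows_pmf n l p u)"
    by (intro nn_integral_cong_AE AE_pmfI) simp
  also have "\<dots> = 1 + (\<integral>\<^sup>+ h. ennreal (real (delivery_time g n l h ?v t)) \<partial>other_rows_pmf n l p u)"
    by (subst nn_integral_add) simp_all
  also have "\<dots> = 1 + (\<integral>\<^sup>+ \<omega>. ennreal (real (delivery_time g n l \<omega> ?v t)) \<partial>network_pmf n l p)"
    by (simp add: nn_integral_delivery_time_other_rows[OF assms(1-4) v])
  finally show "(\<integral>\<^sup>+ h. ennreal (real (delivery_time g n l (join_row l u f h) u t))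
      \<partial>other_rows_pmf n l p u) = \<dots>" .
qed

section \<open>Probability of a present link that halves the distance\<close>

lemma prob_link_half_ge:
  assumes "n \<ge> 2" "u \<in> {1..n}" "t \<in> {1..n}" "u \<noteq> t"
  shows "1 / (8 * log 2 (real n)) \<le>
    measure_pmf.prob (link_pmf n u) {v. node_dist v t \<le> node_dist u t / 2}"
proof -
  define d where "d = (if t < u then u - t else t - u)"
  \<comment> \<open>Only the side of \<open>t\<close> facing \<open>u\<close> is taken, which keeps
    \<open>S\<close> inside \<open>{1..n}\<close>; \<open>u\<close> is excluded since
    \<open>d div 2 < d\<close>.\<close>
  define S where "S = (if t < u then {t..t + d div 2} else {t - d div 2..t})"
  let ?Z = "\<Sum>v' \<in> {1..n} - {u}. 1 / node_dist u v'"
  have d: "real d = node_dist u t" "d \<ge> 1"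
    using assms(4) by (auto simp: d_def node_dist_def)
  have card: "card S = d div 2 + 1"
    using assms(2,3) by (auto simp: S_def d_def)
  have S: "v \<in> {1..n} - {u}" "node_dist u v \<le> real d" "node_dist v t \<le> node_dist u t / 2"
    if "v \<in> S" for v
    using that assms(2-4) by (auto simp: S_def d_def node_dist_def abs_if split: if_splits)
  have Z: "0 < ?Z" "?Z \<le> 4 * log 2 (real n)"
    using link_sum_pos[OF assms(1)] link_sum_le[OF assms(1,2)] by auto
  have "1 / (8 * log 2 (real n)) = (1 / 2) / (4 * log 2 (real n))" by simp
  also have "\<dots> \<le> (1 / 2) / ?Z"
    using Z by (intro divide_left_mono mult_pos_pos) auto
  also have "\<dots> \<le> (real (card S) * (1 / real d)) / ?Z"
  proof (intro divide_right_mono)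
    \<comment> \<open>Counting \<open>t\<close> itself makes up for the rounding in
      \<open>d div 2\<close>.\<close>
    have "d \<le> 2 * card S" unfolding card by simp
    then have "real d \<le> 2 * real (card S)" by linarith
    then show "1 / 2 \<le> real (card S) * (1 / real d)" using d(2) by (simp add: field_simps)
  qed (use Z in simp)
  also have "\<dots> = (\<Sum>v\<in>S. (1 / real d) / ?Z)" by simp
  also have "\<dots> \<le> (\<Sum>v\<in>S. link_prob n u v)"
  proof (rule sum_mono)
    fix v assume "v \<in> S"
    note v = S[OF this]
    have "0 < node_dist u v" using v(1) by (intro node_dist_pos) auto
    then have "1 / real d \<le> 1 / node_dist u v"
      using v(2) d(2) by (intro divide_left_mono mult_pos_pos) auto
    then have "(1 / real d) / ?Z \<le> (1 / node_dist u v) / ?Z"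
      using Z(1) by (intro divide_right_mono) auto
    then show "(1 / real d) / ?Z \<le> link_prob n u v" using v(1) by (simp add: link_prob_def)
  qed
  also have "\<dots> = measure_pmf.prob (link_pmf n u) S"
    by (simp add: measure_measure_pmf_finite pmf_link_pmf[OF assms(1)] S_def)
  also have "\<dots> \<le> measure_pmf.prob (link_pmf n u) {v. node_dist v t \<le> node_dist u t / 2}"
    using S(3) by (intro measure_pmf.finite_measure_mono) auto
  finally show ?thesis .
qed

lemma hop_le_link:
  assumes "greedy_rule g" "i < l" "snd (f (u, i))"
  shows "node_dist (hop g n l f t u) t \<le> node_dist (fst (f (u, i))) t"
proof -
  let ?N = "neighbours n l f u"
  have "finite ?N" unfolding neighbours_def by auto
  moreover have i: "fst (f (u, i)) \<in> ?N" using assms(2,3) unfolding neighbours_def by blast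
  ultimately have "is_arg_min (\<lambda>v. node_dist v t) (\<lambda>v. v \<in> ?N) (hop g n l f t u)"
    using assms(1) unfolding greedy_rule_def hop_def by blast
  with i show ?thesis unfolding is_arg_min_def by (metis linorder_not_less)
qed

text \<open>The \<open>l\<close> links of \<open>u\<close> fail independently, so all fail with
  probability \<open>(1 - x) ^ l\<close>, where \<open>x\<close> is the chance that a single link is
  present and halves the distance.\<close>

lemma prob_row_half_ge:
  assumes "n \<ge> 2" "u \<in> {1..n}" "t \<in> {1..n}" "u \<noteq> t" "0 < p" "p \<le> 1" "real l \<le> log 2 (real n)"
  shows "p * real l / (9 * log 2 (real n)) \<le>
    measure_pmf.prob (row_pmf n l p u)
      {f. \<exists>i<l. snd (f (u, i)) \<and> node_dist (fst (f (u, i))) t \<le> node_dist u t / 2}"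
proof -
  let ?L = "log 2 (real n)" and ?H = "{v. node_dist v t \<le> node_dist u t / 2}"
  let ?A = "{u} \<times> {..<l}" and ?G = "{f. \<exists>i<l. snd (f (u, i)) \<and> fst (f (u, i)) \<in> ?H}"
  define x where "x = p * measure_pmf.prob (link_pmf n u) ?H"
  define y where "y = p / (8 * ?L)"
  have L: "?L \<ge> 1" using assms(1) by simp
  have x: "0 \<le> x" "x \<le> 1" using assms(5,6) by (auto simp: x_def intro: mult_le_one)
  have y: "0 \<le> y" "y \<le> x"
    using mult_left_mono[OF prob_link_half_ge[OF assms(1-4)], of p] assms(5) L
    by (auto simp: x_def y_def)
  \<comment> \<open>Here \<open>real l \<le> log 2 (real n)\<close> enters: it keeps
    \<open>1 + real l * y\<close> below \<open>9 / 8\<close>, which turns the factor 8 of a single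
    link into 9.\<close>
  have ly: "real l * y \<le> 1 / 8"
  proof -
    have "real l * p \<le> ?L * 1" using assms(5-7) L by (intro mult_mono) auto
    then show ?thesis using L by (simp add: y_def field_simps)
  qed
  \<comment> \<open>The failure event is a product set, so its probability factors over the
    links.\<close>
  have "- ?G = Pi ?A (\<lambda>_. - (?H \<times> {True}))"
    by (auto simp: Pi_def mem_Times_iff)
  then have "measure_pmf.prob (row_pmf n l p u) (- ?G) =
    (\<Prod>z\<in>?A. measure_pmf.prob (endpoint_pmf n p z) (- (?H \<times> {True})))"
    unfolding row_pmf_def by (simp only:) (rule measure_Pi_pmf_Pi, simp)
  also have "\<dots> = (\<Prod>z\<in>?A. 1 - x)"
  proof (rule prod.cong[OF refl])
    fix z assume "z \<in> ?A"
    then obtain i where z: "z = (u, i)" by auto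
    have "measure_pmf.prob (pair_pmf (link_pmf n u) (bernoulli_pmf p)) (?H \<times> {True}) = x"
      using assms(5,6)
      by (subst measure_pmf_prob_product) (auto simp: x_def measure_pmf_single mult.commute)
    then show "measure_pmf.prob (endpoint_pmf n p z) (- (?H \<times> {True})) = 1 - x"
      using measure_pmf.prob_compl[of "?H \<times> {True}" "pair_pmf (link_pmf n u) (bernoulli_pmf p)"]
      by (simp add: z Compl_eq_Diff_UNIV)
  qed
  also have "\<dots> = (1 - x) ^ l" by simp
  finally have compl: "measure_pmf.prob (row_pmf n l p u) (- ?G) = (1 - x) ^ l" .
  have "p * real l / (9 * ?L) = real l * y / (1 + 1 / 8)"
    using L by (simp add: y_def field_simps)
  also have "\<dots> \<le> real l * y / (1 + real l * y)"
    using ly y by (intro divide_left_mono mult_pos_pos add_pos_nonneg mult_nonneg_nonneg) auto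
  also have "\<dots> = 1 - 1 / (1 + real l * y)"
    using y by (simp add: field_simps add_pos_nonneg less_imp_neq[THEN not_sym])
  also have "\<dots> \<le> 1 - (1 - y) ^ l"
    using one_minus_power_le[of y l] x y by simp
  also have "\<dots> \<le> 1 - (1 - x) ^ l"
    using power_mono[of "1 - x" "1 - y" l] x y by simp
  also have "\<dots> = measure_pmf.prob (row_pmf n l p u) ?G"
    using measure_pmf.prob_compl[of ?G "row_pmf n l p u"] compl
    by (simp add: Compl_eq_Diff_UNIV)
  finally show ?thesis by simp
qed

section \<open>Drift of the potential and the induction on the distance\<close>

lemma finite_set_row_pmf:
  assumes "n \<ge> 2"
  shows "finite (set_pmf (row_pmf n l p u))"
proof -
  have "finite (set_pmf (link_pmf n u))"
    using set_link_pmf[OF assms] by (rule finite_subset) simp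
  then show ?thesis
    unfolding row_pmf_def by (subst set_Pi_pmf) (auto intro!: finite_PiE_dflt)
qed

text \<open>Greedy choice is at least as good as any present link, so on \<open>?G\<close> the
  potential loses 1. Off \<open>?G\<close> it does not grow, because every hop moves closer.
  Integrating the indicator of \<open>?G\<close> gives the drift.\<close>

lemma expectation_potential_after_hop:
  assumes "greedy_rule g" "n \<ge> 2" "u \<in> {1..n}" "t \<in> {1..n}" "u \<noteq> t"
    and "0 < p" "p \<le> 1" "real l \<le> log 2 (real n)"
  shows "measure_pmf.expectation (row_pmf n l p u)
      (\<lambda>f. log_potential (node_dist (hop g n l f t u) t))
    \<le> log_potential (node_dist u t) - p * real l / (9 * log 2 (real n))"
proof -
  let ?G = "{f. \<exists>i<l. snd (f (u, i)) \<and> node_dist (fst (f (u, i))) t \<le> node_dist u t / 2}"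
  let ?R = "row_pmf n l p u"
  have d: "1 \<le> node_dist u t" using assms(5) by (auto simp: node_dist_def)
  have int: "integrable (measure_pmf ?R) F" for F :: "network \<Rightarrow> real"
    by (rule integrable_measure_pmf_finite[OF finite_set_row_pmf[OF assms(2)]])
  have "log_potential (node_dist (hop g n l f t u) t)
      \<le> log_potential (node_dist u t) - indicator ?G f" if f: "f \<in> set_pmf ?R" for f
  proof (cases "f \<in> ?G")
    case True
    then obtain i where i: "i < l" "snd (f (u, i))"
      and half: "node_dist (fst (f (u, i))) t \<le> node_dist u t / 2" by blast
    have "node_dist (hop g n l f t u) t \<le> node_dist u t / 2"
      using hop_le_link[OF assms(1), of i l f u n t] i half by simp
    then have "log_potential (node_dist (hop g n l f t u) t) \<le> log_potential (node_dist u t / 2)"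
      by (rule log_potential_mono)
    also have "\<dots> \<le> log_potential (node_dist u t) - 1" by (rule log_potential_half[OF d])
    finally show ?thesis using True by simp
  next
    case False
    then show ?thesis
      using hop_row(2)[OF assms(1-5) f] by (auto intro!: log_potential_mono)
  qed
  then have "measure_pmf.expectation ?R (\<lambda>f. log_potential (node_dist (hop g n l f t u) t))
      \<le> measure_pmf.expectation ?R (\<lambda>f. log_potential (node_dist u t) - indicator ?G f)"
    by (intro integral_mono_AE int AE_pmfI)
  also have "\<dots> = log_potential (node_dist u t) - measure_pmf.prob ?R ?G"
    by (subst Bochner_Integration.integral_diff[OF int int]) simp
  also have "\<dots> \<le> log_potential (node_dist u t) - p * real l / (9 * log 2 (real n))"
    using prob_row_half_ge[OF assms(2-8)] by simp
  finally show ?thesis .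
qed

lemma nn_integral_delivery_time_le:
  assumes "greedy_rule g" "n \<ge> 2" "t \<in> {1..n}"
    and "0 < p" "p \<le> 1" "1 \<le> l" "real l \<le> log 2 (real n)"
    and "u \<in> {1..n}"
  shows "(\<integral>\<^sup>+ \<omega>. ennreal (real (delivery_time g n l \<omega> u t)) \<partial>network_pmf n l p)
    \<le> ennreal (log_potential (node_dist u t) / (p * real l / (9 * log 2 (real n))))"
proof -
  define q where "q = p * real l / (9 * log 2 (real n))"
  let ?\<Phi> = "\<lambda>v. log_potential (node_dist v t)"
  let ?T = "\<lambda>v. \<integral>\<^sup>+ \<omega>. ennreal (real (delivery_time g n l \<omega> v t)) \<partial>network_pmf n l p"
  have q: "q > 0" using assms(2,4,6) by (simp add: q_def)
  \<comment> \<open>\<open>m\<close> is only an upper bound on the distance, since one hop may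
    shorten it by any amount.\<close>
  have "?T u \<le> ennreal (?\<Phi> u / q)" if "u \<in> {1..n}" "node_dist u t \<le> real m" for u m
    using that
  proof (induction m arbitrary: u)
    case 0
    then have "u = t" by (simp add: node_dist_def)
    then show ?case by (simp add: delivery_time_target)
  next
    case (Suc m)
    show ?case
    proof (cases "u = t")
      case True
      then show ?thesis by (simp add: delivery_time_target)
    next
      case False
      let ?R = "row_pmf n l p u"
      have int: "integrable (measure_pmf ?R) F" for F :: "network \<Rightarrow> real"
        by (rule integrable_measure_pmf_finite[OF finite_set_row_pmf[OF assms(2)]])
      have "?T u = (\<integral>\<^sup>+ f. 1 + ?T (hop g n l f t u) \<partial>?R)"
        by (rule nn_integral_delivery_time_step[OF assms(1,2) Suc.prems(1) assms(3) False])
      also have "\<dots> \<le> (\<integral>\<^sup>+ f. ennreal (1 + ?\<Phi> (hop g n l f t u) / q) \<partial>?R)"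
      proof (intro nn_integral_mono_AE AE_pmfI)
        fix f assume f: "f \<in> set_pmf ?R"
        note v = hop_row[OF assms(1,2) Suc.prems(1) assms(3) False f]
        have "?T (hop g n l f t u) \<le> ennreal (?\<Phi> (hop g n l f t u) / q)"
          using v Suc.prems(2) by (intro Suc.IH) auto
        then have "1 + ?T (hop g n l f t u) \<le> ennreal 1 + ennreal (?\<Phi> (hop g n l f t u) / q)"
          by (intro add_mono) simp_all
        then show "1 + ?T (hop g n l f t u) \<le> ennreal (1 + ?\<Phi> (hop g n l f t u) / q)"
          using q by (simp add: ennreal_plus log_potential_nonneg del: ennreal_1)
      qed
      \<comment> \<open>The drift estimate concerns real expectations; finite support of the row
        permits the change of integral.\<close>
      also have "\<dots> = ennreal (measure_pmf.expectation ?R (\<lambda>f. 1 + ?\<Phi> (hop g n l f t u) / q))"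
        using q by (intro nn_integral_eq_integral int) (simp add: log_potential_nonneg)
      also have "measure_pmf.expectation ?R (\<lambda>f. 1 + ?\<Phi> (hop g n l f t u) / q) =
          1 + measure_pmf.expectation ?R (\<lambda>f. ?\<Phi> (hop g n l f t u)) / q"
        by (subst Bochner_Integration.integral_add[OF int int]) simp
      also have "ennreal \<dots> \<le> ennreal (1 + (?\<Phi> u - q) / q)"
        using expectation_potential_after_hop[OF assms(1,2) Suc.prems(1) assms(3) False assms(4,5,7)] q
        by (intro ennreal_leI add_left_mono divide_right_mono) (simp_all add: q_def)
      \<comment> \<open>The expected loss \<open>q\<close> pays exactly for the hop just
        made.\<close>
      also have "1 + (?\<Phi> u - q) / q = ?\<Phi> u / q" using q by (simp add: field_simps)
      finally show ?thesis .
    qed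
  qed
  from this[OF assms(8), of "nat \<lceil>node_dist u t\<rceil>"] show ?thesis
    using real_nat_ceiling_ge unfolding q_def by blast
qed

section \<open>The bound in terms of the number of nodes\<close>

theorem theorem7:
  "\<exists>C > 0. \<forall>(n::nat) (l::nat) (p::real) g s t.
     1 \<le> l \<longrightarrow> real l \<le> log 2 (real n) \<longrightarrow>
     0 < p \<longrightarrow> p \<le> 1 \<longrightarrow>
     greedy_rule g \<longrightarrow>
     s \<in> {1..n} \<longrightarrow> t \<in> {1..n} \<longrightarrow>
     expected_delivery_time g n l p s t \<le> C * (log 2 (real n))\<^sup>2 / (p * real l)"
\<comment> \<open>18 is 2 times 9: the potential is at most \<open>1 + log 2 (real n)\<close>, hence
  at most twice the logarithm, and the drift has 9 in its denominator.\<close>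
proof (intro exI[of _ 18] conjI allI impI)
  fix n l :: nat and p :: real and g s t
  assume l: "1 \<le> l" "real l \<le> log 2 (real n)" and p: "0 < p" "p \<le> 1"
    and g: "greedy_rule g" and s: "s \<in> {1..n}" and t: "t \<in> {1..n}"
  let ?L = "log 2 (real n)"
  have L: "1 \<le> ?L" using l by linarith
  have n: "n \<ge> 2"
  proof (rule ccontr)
    assume "\<not> n \<ge> 2"
    then have "n = 1" using s by auto
    then show False using L by auto
  qed
  let ?q = "p * real l / (9 * ?L)"
  have q: "?q > 0" using L l p by simp
  have "log_potential (node_dist s t) \<le> log_potential (real n)"
    using s t by (intro log_potential_mono) (auto simp: node_dist_def)
  also have "\<dots> \<le> 2 * ?L" using n L by (simp add: log_potential_def)
  finally have pot: "log_potential (node_dist s t) \<le> 2 * ?L" .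
  have "ennreal (expected_delivery_time g n l p s t) =
      (\<integral>\<^sup>+ \<omega>. ennreal (real (delivery_time g n l \<omega> s t)) \<partial>network_pmf n l p)"
    unfolding expected_delivery_time_def
    by (rule nn_integral_eq_integral[symmetric]) (simp_all add: integrable_delivery_time[OF n])
  also have "\<dots> \<le> ennreal (log_potential (node_dist s t) / ?q)"
    by (rule nn_integral_delivery_time_le[OF g n t p l s])
  finally have "expected_delivery_time g n l p s t \<le> log_potential (node_dist s t) / ?q"
    \<comment> \<open>Nonnegativity of the right-hand side is required because
      \<open>ennreal\<close> sends negative reals to 0.\<close>
    using divide_nonneg_pos[OF log_potential_nonneg q] by (subst (asm) ennreal_le_iff)
  also have "\<dots> \<le> (2 * ?L) / ?q"
    using pot q by (intro divide_right_mono) auto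
  also have "\<dots> = 18 * ?L\<^sup>2 / (p * real l)"
    by (simp add: power2_eq_square)
  finally show "expected_delivery_time g n l p s t \<le> 18 * ?L\<^sup>2 / (p * real l)" .
qed simp

end
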